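(* Let $P$ be a convex Euclidean $n$-gon. There are placements of the puncture $p$ in the interior of $P$ such that, for the resulting punctured polygon $P^\star$, the natural embedding $\mathcal{A}_n\hookrightarrow\overline{\mathcal{F}}(P^\star)$ is strongly convex.
   Context: Let $P$ be a convex Euclidean $n$-gon ($n\ge 3$), and let $P^\star$ denote $P$ together with a chosen point $p$ in its interior, called the puncture. The marked points of $P$ are its vertices; the marked points of $P^\star$ are the vertices of $P$ and $p$. For each of $P$ and $P^\star$, an arc is a Euclidean line segment joining two distinct marked points with no marked point in its interior; two arcs are non-crossing if their interiors are disjoint; a triangulation is a maximal set of pairwise non-crossing arcs (including the boundary edges of $P$). The flip-graphs $\mathcal{F}(P)$ and $\mathcal{F}(P^\star)$ have as vertices the triangulations of $P$, respectively of $P^\star$, with two triangulations joined by an edge when they differ by a single arc. Since $P$ is convex, $\mathcal{F}(P)$ is isomorphic to $\mathcal{A}_n$, the graph ($1$-skeleton) of the associahedron, i.e. the flip-graph of triangulations of a convex $n$-gon. Flipping the puncture into a triangulation $T$ of $P$ means the following. If $p$ lies in the interior of a triangle $t$ of $T$, add the three segments joining $p$ to the vertices of $t$. If $p$ lies on an edge $\varepsilon$ of $T$, remove $\varepsilon$ and add the four segments joining $p$ to the vertices of the quadrilateral formed by the two triangles of $T$ incident to $\varepsilon$. In both cases the result is a triangulation of $P^\star$. The graph $\overline{\mathcal{F}}(P^\star)$ is obtained from the disjoint union of $\mathcal{F}(P)$ and $\mathcal{F}(P^\star)$ by adding an edge between a triangulation $T$ of $P$ and a triangulation $T'$ of $P^\star$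 whenever $T'$ is obtained by flipping the puncture into $T$. The natural embedding $\mathcal{A}_n\hookrightarrow\overline{\mathcal{F}}(P^\star)$ identifies $\mathcal{A}_n$ with the subgraph $\mathcal{F}(P)$. A subgraph $X$ of a graph $Y$ is strongly convex in $Y$ if every geodesic (shortest path) of $Y$ between any two vertices of $X$ lies entirely in $X$. An embedding of graphs is strongly convex if its image is a strongly convex subgraph. *)

theory Defs
  imports "HOL-Analysis.Analysis" "Graph_Theory.Digraph_Component_Vwalk"
begin

section \<open>Strongly convex embeddings of graphs\<close>

text \<open>Simple undirected graphs are symmetric pair digraphs: every edge is present
  as two opposite arcs.\<close>

definition geodesic :: "'a pair_pre_digraph \<Rightarrow> 'a \<Rightarrow> 'a \<Rightarrow> 'a vwalk \<Rightarrow> bool" where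
  "geodesic Y u v xs \<longleftrightarrow>
     vpath xs Y \<and> hd xs = u \<and> last xs = v \<and>
     (\<forall>ys. vpath ys Y \<and> hd ys = u \<and> last ys = v \<longrightarrow> vwalk_length xs \<le> vwalk_length ys)"

definition strongly_convex :: "'a pair_pre_digraph \<Rightarrow> 'a pair_pre_digraph \<Rightarrow> bool" where
  "strongly_convex X Y \<longleftrightarrow>
     subgraph X Y \<and>
     (\<forall>u \<in> pverts X. \<forall>v \<in> pverts X. \<forall>xs. geodesic Y u v xs \<longrightarrow> vpath xs X)"

definition graph_image :: "('a \<Rightarrow> 'b) \<Rightarrow> 'a pair_pre_digraph \<Rightarrow> 'b pair_pre_digraph" where
  "graph_image f X = \<lparr> pverts = f ` pverts X, parcs = map_prod f f ` parcs X \<rparr>"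

definition strongly_convex_embedding ::
    "('a \<Rightarrow> 'b) \<Rightarrow> 'a pair_pre_digraph \<Rightarrow> 'b pair_pre_digraph \<Rightarrow> bool" where
  "strongly_convex_embedding f X Y \<longleftrightarrow>
     inj_on f (pverts X) \<and> strongly_convex (graph_image f X) Y"

section \<open>Convex polygons and triangulations\<close>

type_synonym point = "real ^ 2"

definition polygon_vertices :: "point set \<Rightarrow> point set" where
  "polygon_vertices P = {v. v extreme_point_of P}"

definition convex_ngon :: "nat \<Rightarrow> point set \<Rightarrow> bool" where
  "convex_ngon n P \<longleftrightarrow>
     n \<ge> 3 \<and> polytope P \<and> interior P \<noteq> {} \<and> card (polygon_vertices P) = n"

definition marked_arcs :: "point set \<Rightarrow> point set set" where
  "marked_arcs M =
     {closed_segment a b | a b. a \<in> M \<and> b \<in> M \<and> a \<noteq> b \<and> open_segment a b \<inter> M = {}}"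

text \<open>For an arc with end points \<open>a \<noteq> b\<close>, the relative interior is \<open>open_segment a b\<close>.\<close>

definition noncrossing :: "point set \<Rightarrow> point set \<Rightarrow> bool" where
  "noncrossing e f \<longleftrightarrow> rel_interior e \<inter> rel_interior f = {}"

text \<open>For the marked points of a convex polygon, punctured or not, a boundary edge crosses
  no other arc, so maximality forces every triangulation to contain the boundary edges.\<close>

definition triangulation :: "point set \<Rightarrow> point set set \<Rightarrow> bool" where
  "triangulation M T \<longleftrightarrow>
     T \<subseteq> marked_arcs M \<and> pairwise noncrossing T \<and>
     (\<forall>T'. T \<subseteq> T' \<and> T' \<subseteq> marked_arcs M \<and> pairwise noncrossing T' \<longrightarrow> T' = T)"

section \<open>Flip-graphs\<close>

definition differ_by_single_arc :: "point set set \<Rightarrow> point set set \<Rightarrow> bool" where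
  "differ_by_single_arc T T' \<longleftrightarrow> card (T - T') = 1 \<and> card (T' - T) = 1"

definition flip_graph :: "point set \<Rightarrow> point set set pair_pre_digraph" where
  "flip_graph M =
     \<lparr> pverts = {T. triangulation M T},
       parcs = {(T, T'). triangulation M T \<and> triangulation M T' \<and> differ_by_single_arc T T'} \<rparr>"

text \<open>In a triangulation of a convex polygon, three vertices pairwise joined by arcs always
  span one of its triangular faces: no vertex lies inside, and a further arc meeting the
  interior of the triangle would cross one of its sides.\<close>

definition triangle_in :: "point set set \<Rightarrow> point \<Rightarrow> point \<Rightarrow> point \<Rightarrow> bool" where
  "triangle_in T a b c \<longleftrightarrow>
     a \<noteq> b \<and> b \<noteq> c \<and> a \<noteq> c \<and>
     closed_segment a b \<in> T \<and> closed_segment b c \<in> T \<and> closed_segment a c \<in> T"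

inductive flips_puncture_into :: "point \<Rightarrow> point set set \<Rightarrow> point set set \<Rightarrow> bool"
  for p :: point and T :: "point set set" where
  in_triangle:
    "triangle_in T a b c \<Longrightarrow> p \<in> interior (convex hull {a, b, c}) \<Longrightarrow>
     flips_puncture_into p T
       (T \<union> {closed_segment p a, closed_segment p b, closed_segment p c})"
| on_edge:
    "triangle_in T a b c \<Longrightarrow> triangle_in T a b d \<Longrightarrow> c \<noteq> d \<Longrightarrow> p \<in> open_segment a b \<Longrightarrow>
     flips_puncture_into p T
       (T - {closed_segment a b} \<union>
        {closed_segment p a, closed_segment p b, closed_segment p c, closed_segment p d})"

text \<open>The disjoint union of the two flip-graphs together with the puncture flips; the
  triangulations of \<open>P\<close> are tagged by \<open>Inl\<close>, those of the polygon punctured at \<open>p\<close>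
  by \<open>Inr\<close>.\<close>

definition puncture_edges ::
    "point set \<Rightarrow> point \<Rightarrow> (point set set + point set set) rel" where
  "puncture_edges P p =
     {(Inl T, Inr T') | T T'.
        triangulation (polygon_vertices P) T \<and>
        triangulation (insert p (polygon_vertices P)) T' \<and>
        flips_puncture_into p T T'}"

definition extended_flip_graph ::
    "point set \<Rightarrow> point \<Rightarrow> (point set set + point set set) pair_pre_digraph" where
  "extended_flip_graph P p =
     (let F = flip_graph (polygon_vertices P);
          F' = flip_graph (insert p (polygon_vertices P))
      in \<lparr> pverts = Inl ` pverts F \<union> Inr ` pverts F',
           parcs = map_prod Inl Inl ` parcs F \<union> map_prod Inr Inr ` parcs F' \<union>
                   puncture_edges P p \<union> (puncture_edges P p)\<inverse> \<rparr>)"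

end

theory Submission
  imports Defs
begin

text \<open>Fix a vertex \<open>a\<close> and place \<open>p\<close> in the interior of \<open>P\<close>, outside the convex hull of
  the other vertices; then \<open>p\<close> and \<open>a\<close> lie on the same side of each line through two vertices
  other than \<open>a\<close>. Dragging \<open>p\<close> onto \<open>a\<close> therefore turns each triangulation of the punctured
  polygon into a triangulation of \<open>P\<close>. This map is a retraction of the extended flip-graph
  onto the flip-graph of \<open>P\<close> which does not increase distances and which collapses each puncture
  edge. A path between triangulations of \<open>P\<close> that leaves the flip-graph of \<open>P\<close> uses puncture
  edges, so its image is strictly shorter and it is not a geodesic.\<close>

section \<open>Retractions of graphs\<close>

text \<open>Cutting out cycles only drops vertices. This turns a short walk into a competitor for
  \<open>geodesic\<close>, which compares paths only.\<close>

lemma length_vwalk_to_vpath_le: "length (vwalk_to_vpath xs) \<le> length xs"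
proof (induction xs rule: vwalk_to_vpath_induct3)
  case (in_set x xs)
  then show ?case
    using length_dropWhile_le[of "\<lambda>y. y \<noteq> x" xs] by simp
qed auto

text \<open>Induction from the front: an arc with \<open>f u = f v\<close> saves a vertex, any other
  arc is mapped to an arc of \<open>X\<close>. A walk that starts in \<open>X\<close> and leaves it
  takes an arc out of \<open>X\<close>, and \<open>collapse\<close> makes the image strictly shorter
  there.\<close>

lemma vwalk_retract:
  fixes X Y :: "'a pair_pre_digraph"
  assumes "vwalk xs Y"
    and verts: "\<And>v. v \<in> pverts Y \<Longrightarrow> f v \<in> pverts X"
    and step: "\<And>u v. (u, v) \<in> parcs Y \<Longrightarrow> f u = f v \<or> (f u, f v) \<in> parcs X"
    and collapse: "\<And>u v. \<lbrakk>(u, v) \<in> parcs Y; u \<in> pverts X; v \<notin> pverts X\<rbrakk> \<Longrightarrow> f u = f v"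
    and wf: "wf_digraph Y"
  shows "\<exists>ys. vwalk ys X \<and> hd ys = f (hd xs) \<and> last ys = f (last xs) \<and> length ys \<le> length xs \<and>
           (hd xs \<in> pverts X \<and> \<not> set xs \<subseteq> pverts X \<longrightarrow> length ys < length xs)"
  using assms(1)
proof (induction xs)
  case (Base u)
  then have "vwalk [f u] X"
    using verts by auto
  then show ?case
    by (intro exI[of _ "[f u]"]) auto
next
  case (Cons u v es)
  from Cons.IH obtain ys where ys: "vwalk ys X" "hd ys = f v" "last ys = f (last (v # es))"
    "length ys \<le> length (v # es)"
    "v \<in> pverts X \<and> \<not> set (v # es) \<subseteq> pverts X \<longrightarrow> length ys < length (v # es)"
    by auto
  have uv: "(u, v) \<in> parcs Y"
    using Cons.hyps by simp
  show ?case
  proof (cases "f u = f v")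
    case True
    then show ?thesis
      using ys by (intro exI[of _ ys]) auto
  next
    case False
    have "u \<in> pverts Y"
      using wf_digraph.tail_in_verts[OF wf, of "(u, v)"] uv by simp
    then have "vwalk (f u # ys) X"
      using False step[OF uv] verts ys by (intro vwalk_consI) auto
    moreover have "ys \<noteq> []"
      using ys(1) by auto
    \<comment> \<open>An arc that starts in \<open>X\<close> and is not collapsed also ends in
      \<open>X\<close>, so strictness is inherited from the rest of the walk.\<close>
    moreover have "v \<in> pverts X" if "u \<in> pverts X"
      using collapse[OF uv that] False by blast
    ultimately show ?thesis
      using ys by (intro exI[of _ "f u # ys"]) auto
  qed
qed

text \<open>Because \<open>f\<close> fixes \<open>X\<close>, the image of a geodesic between
  vertices of \<open>X\<close> has the same ends; had the geodesic left \<open>X\<close>, this image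
  would be shorter. Hence all its vertices lie in \<open>X\<close>, and \<open>induced\<close>
  brings its arcs along.\<close>

lemma strongly_convex_retract:
  fixes X Y :: "'a pair_pre_digraph"
  assumes sub: "subgraph X Y"
    and induced: "\<And>u v. \<lbrakk>(u, v) \<in> parcs Y; u \<in> pverts X; v \<in> pverts X\<rbrakk> \<Longrightarrow> (u, v) \<in> parcs X"
    and verts: "\<And>v. v \<in> pverts Y \<Longrightarrow> f v \<in> pverts X"
    and fixed: "\<And>v. v \<in> pverts X \<Longrightarrow> f v = v"
    and step: "\<And>u v. (u, v) \<in> parcs Y \<Longrightarrow> f u = f v \<or> (f u, f v) \<in> parcs X"
    and collapse: "\<And>u v. \<lbrakk>(u, v) \<in> parcs Y; u \<in> pverts X; v \<notin> pverts X\<rbrakk> \<Longrightarrow> f u = f v"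
  shows "strongly_convex X Y"
  unfolding strongly_convex_def
proof (intro conjI ballI allI impI)
  fix u v xs
  assume u: "u \<in> pverts X" and v: "v \<in> pverts X" and "geodesic Y u v xs"
  then have path: "vpath xs Y" and ends: "hd xs = u" "last xs = v"
    and shortest: "\<And>ys. \<lbrakk>vpath ys Y; hd ys = u; last ys = v\<rbrakk> \<Longrightarrow> vwalk_length xs \<le> vwalk_length ys"
    by (auto simp: geodesic_def)
  have walk: "vwalk xs Y"
    using path by auto
  have wf: "wf_digraph Y"
    using sub by (auto simp: subgraph_def)
  have inside: "set xs \<subseteq> pverts X"
  proof (rule ccontr)
    assume "\<not> set xs \<subseteq> pverts X"
    then obtain ys where ys: "vwalk ys X" "hd ys = u" "last ys = v" "length ys < length xs"
      using vwalk_retract[where f = f and X = X, OF walk verts step collapse wf]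
      unfolding ends fixed[OF u] fixed[OF v] using u by blast
    let ?zs = "vwalk_to_vpath ys"
    have "vpath ?zs X"
      using ys(1) by (rule vwalk_to_vpath_vpath)
    then have "vpath ?zs Y"
      using sub by (auto simp: vpath_def vwalk_def subgraph_def)
    then have "vwalk_length xs \<le> vwalk_length ?zs"
      using ys by (intro shortest) (auto simp: vwalk_to_vpath_hd vwalk_to_vpath_last)
    \<comment> \<open>\<open>vwalk_length\<close> counts arcs, one fewer than the vertices of a
      nonempty list; nonemptiness rules out truncated subtraction.\<close>
    moreover have "?zs \<noteq> []"
      using ys(1) by (intro vwalk_to_vpath_nonempty) auto
    ultimately show False
      using ys(4) length_vwalk_to_vpath_le[of ys] by (cases ?zs) auto
  qed
  have "set (vwalk_arcs xs) \<subseteq> parcs X"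
  proof
    fix e
    assume e: "e \<in> set (vwalk_arcs xs)"
    then have "e \<in> parcs Y" "e \<in> set xs \<times> set xs"
      using walk arcs_in_vwalk_arcs[OF e] by (auto simp: vwalk_def)
    then show "e \<in> parcs X"
      using induced inside by auto
  qed
  then show "vpath xs X"
    using path inside by (auto simp: vpath_def vwalk_def)
qed (rule sub)

section \<open>Sides of a line and crossing arcs\<close>

text \<open>The determinant of \<open>z - y\<close> and \<open>u - y\<close>: its sign tells on
  which side of the oriented line from \<open>y\<close> to \<open>z\<close> the point
  \<open>u\<close> lies.\<close>

definition side :: "point \<Rightarrow> point \<Rightarrow> point \<Rightarrow> real" where
  "side y z u = (z $ 1 - y $ 1) * (u $ 2 - y $ 2) - (z $ 2 - y $ 2) * (u $ 1 - y $ 1)"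

lemma side_self [simp]: "side y z y = 0" "side y z z = 0"
  by (simp_all add: side_def)

lemma side_convex_combination:
  "side y z ((1 - t) *\<^sub>R u + t *\<^sub>R x) = (1 - t) * side y z u + t * side y z x"
  by (simp add: side_def algebra_simps)

lemma side_open_segment:
  assumes "r \<in> open_segment u x"
  obtains t where "0 < t" "t < 1" "side y z r = (1 - t) * side y z u + t * side y z x"
  using assms side_convex_combination by (auto simp: in_segment)

lemma side_eq_0_open_segment:
  assumes "r \<in> open_segment y z"
  shows "side y z r = 0"
  using assms by (auto elim: side_open_segment[where y = y and z = z])

text \<open>The parameter \<open>t\<close> is solved for in a coordinate where \<open>y\<close> and
  \<open>z\<close> differ; the vanishing determinant makes the other coordinate agree.\<close>

lemma side_eq_0_imp_collinear:
  assumes "y \<noteq> z" "side y z u = 0"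
  shows "collinear {y, u, z}"
proof -
  have "y $ 1 \<noteq> z $ 1 \<or> y $ 2 \<noteq> z $ 2"
    using assms(1) by (auto simp: vec_eq_iff forall_2)
  then have "\<exists>t. u = t *\<^sub>R y + (1 - t) *\<^sub>R z"
  proof
    assume ne: "y $ 1 \<noteq> z $ 1"
    define t where "t = (u $ 1 - z $ 1) / (y $ 1 - z $ 1)"
    have "t * (y $ 1 - z $ 1) = u $ 1 - z $ 1"
      using ne by (simp add: t_def)
    moreover have "t * (y $ 2 - z $ 2) = u $ 2 - z $ 2"
      using ne assms(2) by (simp add: t_def side_def field_simps)
    ultimately have "u = t *\<^sub>R y + (1 - t) *\<^sub>R z"
      by (simp add: vec_eq_iff forall_2 algebra_simps)
    then show ?thesis ..
  next
    assume ne: "y $ 2 \<noteq> z $ 2"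
    define t where "t = (u $ 2 - z $ 2) / (y $ 2 - z $ 2)"
    have "t * (y $ 2 - z $ 2) = u $ 2 - z $ 2"
      using ne by (simp add: t_def)
    moreover have "t * (y $ 1 - z $ 1) = u $ 1 - z $ 1"
      using ne assms(2) by (simp add: t_def side_def field_simps)
    ultimately have "u = t *\<^sub>R y + (1 - t) *\<^sub>R z"
      by (simp add: vec_eq_iff forall_2 algebra_simps)
    then show ?thesis ..
  qed
  then show ?thesis
    by (simp add: collinear_3_expand)
qed

lemma side_opposite_crossing:
  assumes "side y z u * side y z x < 0"
  obtains r where "r \<in> open_segment u x" "side y z r = 0"
proof -
  \<comment> \<open>The zero of the affine function \<open>side y z\<close> along the segment from
    \<open>u\<close> to \<open>x\<close>.\<close>
  define t where "t = side y z u / (side y z u - side y z x)"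
  have signs: "side y z u < 0 \<and> 0 < side y z x \<or> 0 < side y z u \<and> side y z x < 0"
    using assms by (auto simp: mult_less_0_iff)
  then have "0 < t" "t < 1"
    by (auto simp: t_def divide_simps)
  moreover have "u \<noteq> x"
    using signs by auto
  ultimately have "(1 - t) *\<^sub>R u + t *\<^sub>R x \<in> open_segment u x"
    by (auto simp: in_segment)
  moreover have "side y z ((1 - t) *\<^sub>R u + t *\<^sub>R x) = 0"
    using signs unfolding side_convex_combination by (auto simp: t_def field_simps)
  ultimately show ?thesis
    by (rule that)
qed

lemma noncrossing_closed_segment:
  fixes u x y z :: point
  assumes "u \<noteq> x" "y \<noteq> z"
  shows "noncrossing (closed_segment u x) (closed_segment y z) \<longleftrightarrow>
    open_segment u x \<inter> open_segment y z = {}"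
  using assms by (simp add: noncrossing_def rel_interior_closed_segment)

lemma noncrossing_sym: "noncrossing e f \<longleftrightarrow> noncrossing f e"
  by (auto simp: noncrossing_def)

lemma not_extreme_point_open_segment:
  assumes "v extreme_point_of S" "u \<in> S" "x \<in> S"
  shows "v \<notin> open_segment u x"
  using assms by (auto simp: extreme_point_of_def)

text \<open>Of three collinear points one lies between the other two, and extremality excludes both
  \<open>x\<close> and \<open>w\<close> from that role.\<close>

lemma collinear_extreme_points:
  fixes S :: "'a::euclidean_space set"
  assumes "x extreme_point_of S" "w extreme_point_of S" "x \<noteq> w" "u \<in> S" "collinear {x, u, w}"
  shows "u \<in> closed_segment x w"
proof -
  have "x \<notin> open_segment u w" "w \<notin> open_segment x u"
    using assms by (auto simp: extreme_point_of_def)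
  moreover have "between (u, w) x \<or> between (w, x) u \<or> between (x, u) w"
    using assms(5) collinear_between_cases[of x u w] by blast
  ultimately show ?thesis
    using assms(3) by (auto simp: between_mem_segment closed_segment_eq_open open_segment_commute)
qed

text \<open>Two segments from \<open>u\<close> could overlap only along a common ray, and then one
  of \<open>x\<close> and \<open>w\<close> would lie strictly between \<open>u\<close> and the
  other.\<close>

lemma extreme_points_disjoint_from_common:
  fixes S :: "point set"
  assumes "x extreme_point_of S" "w extreme_point_of S" "x \<noteq> w" "u \<in> S"
  shows "open_segment u x \<inter> open_segment u w = {}"
proof -
  have "u \<in> closed_segment x w \<or> \<not> collinear {x, u, w}"
    using collinear_extreme_points[OF assms] by blast
  then have "closed_segment x u \<inter> closed_segment u w = {u}"
    by (rule Int_closed_segment)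
  then show ?thesis
    by (auto simp: open_segment_def closed_segment_commute)
qed

text \<open>Crossing the line suffices for crossing the segment: the meeting point is in
  \<open>S\<close>, so extremality of \<open>y\<close> and \<open>z\<close> places it between
  them.\<close>

lemma extreme_points_crossing_iff:
  assumes "y extreme_point_of S" "z extreme_point_of S" "y \<noteq> z" "convex S"
    and "u \<in> S" "x \<in> S" "side y z u \<noteq> 0"
  shows "open_segment u x \<inter> open_segment y z \<noteq> {} \<longleftrightarrow> side y z u * side y z x < 0"
proof
  assume "open_segment u x \<inter> open_segment y z \<noteq> {}"
  then obtain r where r: "r \<in> open_segment u x" "r \<in> open_segment y z"
    by auto
  obtain t where t: "0 < t" "t < 1" "side y z r = (1 - t) * side y z u + t * side y z x"
    using side_open_segment[OF r(1)] .
  have "side y z x = - ((1 - t) / t) * side y z u"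
    using t side_eq_0_open_segment[OF r(2)] by (simp add: field_simps)
  then have "side y z u * side y z x = - ((1 - t) / t) * (side y z u)\<^sup>2"
    by (simp add: power2_eq_square)
  also have "\<dots> < 0"
    using t assms(7) by (simp add: mult_less_0_iff)
  finally show "side y z u * side y z x < 0" .
next
  assume "side y z u * side y z x < 0"
  then obtain r where r: "r \<in> open_segment u x" "side y z r = 0"
    by (rule side_opposite_crossing)
  have "r \<in> S"
    using r(1) assms by (meson convex_contains_open_segment subsetD)
  then have "r \<in> closed_segment y z"
    using assms side_eq_0_imp_collinear[OF assms(3) r(2)] by (intro collinear_extreme_points)
  moreover have "r \<noteq> y" "r \<noteq> z"
    using r(1) assms not_extreme_point_open_segment by blast+
  ultimately show "open_segment u x \<inter> open_segment y z \<noteq> {}"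
    using r(1) by (auto simp: open_segment_def)
qed

section \<open>Triangulations\<close>

lemma marked_arcsE:
  assumes "e \<in> marked_arcs M"
  obtains x y where "e = closed_segment x y" "x \<in> M" "y \<in> M" "x \<noteq> y"
    "open_segment x y \<inter> M = {}"
  using assms by (auto simp: marked_arcs_def)

lemma closed_segment_in_marked_arcs_iff:
  "closed_segment x y \<in> marked_arcs M \<longleftrightarrow>
    x \<in> M \<and> y \<in> M \<and> x \<noteq> y \<and> open_segment x y \<inter> M = {}"
  by (auto simp: marked_arcs_def doubleton_eq_iff open_segment_commute)

text \<open>The form in which maximality is used below: an arc missing from a triangulation crosses
  one of its arcs.\<close>

lemma triangulation_memI:
  assumes "triangulation M T" "g \<in> marked_arcs M"
    and "\<And>e. \<lbrakk>e \<in> T; e \<noteq> g\<rbrakk> \<Longrightarrow> noncrossing g e"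
  shows "g \<in> T"
proof -
  have "pairwise noncrossing (insert g T)"
    using assms by (auto simp: triangulation_def pairwise_insert noncrossing_sym)
  moreover have "insert g T \<subseteq> marked_arcs M" "T \<subseteq> insert g T"
    using assms(1,2) by (auto simp: triangulation_def)
  ultimately have "insert g T = T"
    using assms(1) unfolding triangulation_def by blast
  then show ?thesis
    by blast
qed

lemma triangulation_noncrossing:
  assumes "triangulation M T" "e \<in> T" "f \<in> T" "e \<noteq> f"
  shows "noncrossing e f"
  using assms by (auto simp: triangulation_def pairwise_def)

lemma triangulation_subset_eq:
  assumes "triangulation M T" "triangulation M T'" "T \<subseteq> T'"
  shows "T = T'"
  using assms unfolding triangulation_def by blast

section \<open>Contracting the puncture to a vertex\<close>

text \<open>Set-valued because the arc from \<open>p\<close> to \<open>a\<close> shrinks to a point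
  and has no image. Arcs away from \<open>p\<close> stay in place.\<close>

definition contract_arc :: "point \<Rightarrow> point \<Rightarrow> point set \<Rightarrow> point set set" where
  "contract_arc a p e =
     (if p \<in> e then {closed_segment a x | x. x \<noteq> a \<and> e = closed_segment p x} else {e})"

definition contract :: "point \<Rightarrow> point \<Rightarrow> point set set \<Rightarrow> point set set" where
  "contract a p T = (\<Union>e\<in>T. contract_arc a p e)"

lemma mem_contract_iff:
  "g \<in> contract a p T \<longleftrightarrow>
     g \<in> T \<and> p \<notin> g \<or> (\<exists>x. x \<noteq> a \<and> g = closed_segment a x \<and> closed_segment p x \<in> T)"
  by (auto simp: contract_def contract_arc_def split: if_splits)

lemma closed_segment_inject:
  fixes p x y :: "'a::euclidean_space"
  shows "closed_segment p x = closed_segment p y \<longleftrightarrow> x = y"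
  unfolding closed_segment_eq doubleton_eq_iff by blast

text \<open>A segment determines its end points, so contraction acts as a partial function on arcs
  and cannot enlarge a difference of two sets.\<close>

lemma contract_arc_unique:
  assumes "g \<in> contract_arc a p e" "h \<in> contract_arc a p e"
  shows "g = h"
proof (cases "p \<in> e")
  case True
  with assms obtain x y where "g = closed_segment a x" "e = closed_segment p x"
    "h = closed_segment a y" "e = closed_segment p y"
    unfolding contract_arc_def by force
  then show ?thesis
    using closed_segment_inject by metis
next
  case False
  with assms show ?thesis
    by (simp add: contract_arc_def)
qed

lemma contract_arc_subsingleton: "\<exists>g. contract_arc a p e \<subseteq> {g}"
  using contract_arc_unique by blast

lemma contract_diff_subset: "contract a p T - contract a p T' \<subseteq> contract a p (T - T')"
  by (auto simp: contract_def)

text \<open>Finiteness is recorded because \<open>card\<close> of an infinite set is 0, so the bound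
  alone would not give a singleton.\<close>

lemma card_contract_diff_le:
  assumes "card (T - T') = 1"
  shows "finite (contract a p T - contract a p T') \<and> card (contract a p T - contract a p T') \<le> 1"
proof -
  obtain e where "T - T' = {e}"
    using assms by (auto simp: card_1_singleton_iff)
  moreover obtain g where "contract_arc a p e \<subseteq> {g}"
    using contract_arc_subsingleton by blast
  ultimately have "contract a p T - contract a p T' \<subseteq> {g}"
    using contract_diff_subset[of a p T T'] by (auto simp: contract_def)
  then show ?thesis
    using card_mono[of "{g}"] finite_subset[of _ "{g}"] by simp
qed

text \<open>Two distinct triangulations are incomparable by maximality, so both differences are
  nonempty, and each has at most one element.\<close>

lemma contract_flip:
  assumes "triangulation M (contract a p T)" "triangulation M (contract a p T')"
    and "differ_by_single_arc T T'"
  shows "contract a p T = contract a p T' \<or>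
    differ_by_single_arc (contract a p T) (contract a p T')"
proof (cases "contract a p T = contract a p T'")
  case False
  then have "contract a p T - contract a p T' \<noteq> {}" "contract a p T' - contract a p T \<noteq> {}"
    using triangulation_subset_eq[OF assms(1,2)] triangulation_subset_eq[OF assms(2,1)] by auto
  moreover have "card D = 1" if "D \<noteq> {}" "finite D \<and> card D \<le> 1" for D :: "point set set"
    using that card_gt_0_iff[of D] by linarith
  moreover have "card (T - T') = 1" "card (T' - T) = 1"
    using assms(3) by (simp_all add: differ_by_single_arc_def)
  note this[THEN card_contract_diff_le, of a p]
  ultimately have "card (contract a p T - contract a p T') = 1"
    "card (contract a p T' - contract a p T) = 1"
    by simp_all
  then show ?thesis
    by (simp add: differ_by_single_arc_def)
qed simp

text \<open>A puncture flip yields a set of this form, with \<open>X\<close> the corners of the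
  triangle or quadrilateral around \<open>p\<close>.\<close>

lemma contract_star:
  assumes "\<And>e. e \<in> R \<Longrightarrow> p \<notin> e"
  shows "contract a p (R \<union> closed_segment p ` X) = R \<union> closed_segment a ` (X - {a})"
proof -
  have "closed_segment p x \<in> R \<union> closed_segment p ` X \<longleftrightarrow> x \<in> X" for x
    using assms[of "closed_segment p x"] unfolding image_iff Un_iff closed_segment_inject
    by (metis ends_in_segment(1))
  moreover have "g \<in> R \<union> closed_segment p ` X \<and> p \<notin> g \<longleftrightarrow> g \<in> R" for g
    using assms by auto
  ultimately have "g \<in> contract a p (R \<union> closed_segment p ` X) \<longleftrightarrow>
      g \<in> R \<or> (\<exists>x. x \<noteq> a \<and> g = closed_segment a x \<and> x \<in> X)" for g
    by (simp only: mem_contract_iff)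
  then show ?thesis
    by blast
qed

locale puncture_near_vertex =
  fixes P :: "point set" and a p :: point
  assumes hull_vertices: "P = convex hull polygon_vertices P"
    and a_vertex: "a \<in> polygon_vertices P"
    and p_interior: "p \<in> interior P"
    and p_outside: "p \<notin> convex hull (polygon_vertices P - {a})"
begin

abbreviation V :: "point set" where "V \<equiv> polygon_vertices P"

lemma convex_P: "convex P"
  using hull_vertices by (metis convex_convex_hull)

lemma vertex_extreme: "v \<in> V \<Longrightarrow> v extreme_point_of P"
  by (simp add: polygon_vertices_def)

lemma vertex_in_P: "v \<in> V \<Longrightarrow> v \<in> P"
  by (simp add: polygon_vertices_def extreme_point_of_def)

lemma p_in_P: "p \<in> P"
  using p_interior interior_subset by auto

lemma p_not_vertex: "p \<notin> V"
  using p_interior extreme_point_not_in_interior vertex_extreme by blast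

lemma noncrossing_puncture_arc:
  assumes "x \<in> V" "y \<noteq> z"
  shows "noncrossing (closed_segment p x) (closed_segment y z) \<longleftrightarrow>
      open_segment p x \<inter> open_segment y z = {}"
    and "noncrossing (closed_segment y z) (closed_segment p x) \<longleftrightarrow>
      open_segment p x \<inter> open_segment y z = {}"
proof -
  have "p \<noteq> x"
    using assms(1) p_not_vertex by blast
  then show "noncrossing (closed_segment p x) (closed_segment y z) \<longleftrightarrow>
      open_segment p x \<inter> open_segment y z = {}"
    using assms(2) by (rule noncrossing_closed_segment)
  then show "noncrossing (closed_segment y z) (closed_segment p x) \<longleftrightarrow>
      open_segment p x \<inter> open_segment y z = {}"
    by (simp add: noncrossing_sym[of "closed_segment y z"])
qed

section \<open>Arcs of the polygon and of the punctured polygon\<close>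

lemma vertex_not_in_open_segment:
  assumes "v \<in> V" "x \<in> P" "y \<in> P"
  shows "v \<notin> open_segment x y"
  using assms not_extreme_point_open_segment vertex_extreme by blast

lemma closed_segment_subset_hull:
  assumes "y \<in> V - {a}" "z \<in> V - {a}"
  shows "closed_segment y z \<subseteq> convex hull (V - {a})"
  using assms by (simp add: closed_segment_subset_convex_hull hull_inc)

lemma closed_segment_in_arcs:
  assumes "x \<in> V" "y \<in> V" "x \<noteq> y"
  shows "closed_segment x y \<in> marked_arcs V"
  using assms vertex_not_in_open_segment vertex_in_P
  by (auto simp: closed_segment_in_marked_arcs_iff)

lemma closed_segment_in_punctured_arcs:
  assumes "x \<in> V" "y \<in> V" "x \<noteq> y" "p \<notin> open_segment x y"
  shows "closed_segment x y \<in> marked_arcs (insert p V)"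
  using assms vertex_not_in_open_segment vertex_in_P
  by (auto simp: closed_segment_in_marked_arcs_iff)

lemma puncture_arc_in_punctured_arcs:
  assumes "x \<in> V"
  shows "closed_segment p x \<in> marked_arcs (insert p V)"
proof -
  have "open_segment p x \<inter> insert p V = {}"
    using assms vertex_not_in_open_segment vertex_in_P p_in_P by (auto simp: open_segment_def)
  then show ?thesis
    using assms p_not_vertex by (auto simp: closed_segment_in_marked_arcs_iff)
qed

text \<open>Being a marked point itself, \<open>p\<close> can lie on an arc only as an end
  point.\<close>

lemma punctured_arc_cases:
  assumes "e \<in> marked_arcs (insert p V)"
  obtains (puncture) x where "x \<in> V" "e = closed_segment p x" "p \<in> e"
  | (vertices) y z where "y \<in> V" "z \<in> V" "y \<noteq> z" "e = closed_segment y z" "p \<notin> e"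
proof -
  obtain x y where xy: "e = closed_segment x y" "x \<in> insert p V" "y \<in> insert p V" "x \<noteq> y"
    "open_segment x y \<inter> insert p V = {}"
    using assms by (rule marked_arcsE)
  show thesis
  proof (cases "x = p \<or> y = p")
    case True
    then show thesis
      using xy puncture by (auto simp: closed_segment_commute)
  next
    case False
    then show thesis
      using xy vertices[of x y] by (auto simp: closed_segment_eq_open)
  qed
qed

lemma punctured_arcE:
  assumes "e \<in> marked_arcs (insert p V)" "p \<in> e"
  obtains x where "x \<in> V" "e = closed_segment p x"
  using assms(1) by (cases rule: punctured_arc_cases) (use assms(2) that in blast)+

lemma unpunctured_arcE:
  assumes "e \<in> marked_arcs (insert p V)" "p \<notin> e"
  obtains y z where "y \<in> V" "z \<in> V" "y \<noteq> z" "e = closed_segment y z"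
  using assms(1) by (cases rule: punctured_arc_cases) (use assms(2) that in blast)+

section \<open>Position of the puncture relative to the arcs\<close>

lemma crossing_iff:
  assumes "y \<in> V" "z \<in> V" "y \<noteq> z" "u \<in> P" "x \<in> P" "side y z u \<noteq> 0"
  shows "open_segment u x \<inter> open_segment y z \<noteq> {} \<longleftrightarrow> side y z u * side y z x < 0"
  using assms vertex_extreme convex_P by (intro extreme_points_crossing_iff[of _ P])

lemma disjoint_from_common:
  assumes "x \<in> V" "w \<in> V" "x \<noteq> w" "u \<in> P"
  shows "open_segment u x \<inter> open_segment u w = {}"
  using assms vertex_extreme by (intro extreme_points_disjoint_from_common[of _ P])

lemma on_line_imp_on_arc:
  assumes "y \<in> V" "z \<in> V" "y \<noteq> z" "u \<in> P" "side y z u = 0"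
  shows "u \<in> closed_segment y z"
  using assms vertex_extreme side_eq_0_imp_collinear by (intro collinear_extreme_points[of _ P])

text \<open>Otherwise either \<open>p\<close> lies on the arc \<open>y z\<close> itself, or the
  segment from \<open>p\<close> to \<open>a\<close> meets that arc in a point \<open>r\<close> of
  the hull \<open>?K\<close> of the other vertices. Both cases put \<open>p\<close> in
  \<open>?K\<close>.\<close>

lemma same_side:
  assumes y: "y \<in> V - {a}" and z: "z \<in> V - {a}" and "y \<noteq> z"
  shows "0 < side y z p * side y z a"
proof (rule ccontr)
  let ?K = "convex hull (V - {a})"
  note K = closed_segment_subset_hull[OF y z]
  assume "\<not> 0 < side y z p * side y z a"
  moreover have p0: "side y z p \<noteq> 0"
    using on_line_imp_on_arc[of y z p] K y z \<open>y \<noteq> z\<close> p_in_P p_outside by auto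
  moreover have "side y z a \<noteq> 0"
    using on_line_imp_on_arc[of y z a] vertex_not_in_open_segment[OF a_vertex, of y z]
      y z \<open>y \<noteq> z\<close> a_vertex vertex_in_P
    by (auto simp: closed_segment_eq_open)
  ultimately have "side y z p * side y z a < 0"
    by (simp add: not_less order_less_le)
  then have "open_segment p a \<inter> open_segment y z \<noteq> {}"
    using crossing_iff[of y z p a] y z \<open>y \<noteq> z\<close> a_vertex vertex_in_P p_in_P p0 by auto
  then obtain r where r: "r \<in> open_segment p a" "r \<in> ?K"
    using K segment_open_subset_closed by blast
  obtain s where s: "0 < s" "s < 1" "r = (1 - s) *\<^sub>R p + s *\<^sub>R a"
    using r(1) by (auto simp: in_segment)
  \<comment> \<open>\<open>P\<close> is the union of the segments from \<open>a\<close> to points of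
    \<open>?K\<close>; \<open>k\<close> is the far end of one through \<open>p\<close>.\<close>
  have "p \<in> convex hull insert a (V - {a})"
    using p_in_P hull_vertices a_vertex by (simp add: insert_absorb)
  then obtain u v k where k: "0 \<le> u" "0 \<le> v" "u + v = 1" "k \<in> ?K" "p = u *\<^sub>R a + v *\<^sub>R k"
    using y by (subst (asm) convex_hull_insert) auto
  \<comment> \<open>As \<open>p\<close> is on the segment \<open>a k\<close> and \<open>r\<close> between \<open>p\<close> and \<open>a\<close>, \<open>p\<close> lies between \<open>r\<close> and \<open>k\<close>.\<close>
  let ?D = "u + s * v"
  have D: "0 < ?D"
    using k s by (metis add_cancel_right_left add_nonneg_pos add_pos_nonneg le_less mult_pos_pos
        mult_nonneg_nonneg zero_neq_one less_numeral_extra(1))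
  \<comment> \<open>Eliminating \<open>a\<close> from the expressions for \<open>r\<close> and
    \<open>p\<close> leaves \<open>?D\<close> times \<open>p\<close>; dividing by \<open>?D\<close>
    gives a convex combination of \<open>r\<close> and \<open>k\<close>.\<close>
  have "u *\<^sub>R r + (s * v) *\<^sub>R k = (u * (1 - s)) *\<^sub>R p + s *\<^sub>R (u *\<^sub>R a + v *\<^sub>R k)"
    by (simp add: s(3) algebra_simps)
  also have "\<dots> = (u * (1 - s) + s) *\<^sub>R p"
    by (simp add: k(5)[symmetric] algebra_simps)
  also have "u * (1 - s) + s = ?D"
  proof -
    have v: "v = 1 - u"
      using k(3) by simp
    show ?thesis
      unfolding v by (simp add: algebra_simps)
  qed
  finally have "p = (1 / ?D) *\<^sub>R (u *\<^sub>R r + (s * v) *\<^sub>R k)"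
    using D by simp
  then have "p = (u / ?D) *\<^sub>R r + (s * v / ?D) *\<^sub>R k"
    by (simp add: scaleR_add_right)
  moreover have "u / ?D + s * v / ?D = 1"
    using D by (simp add: add_divide_distrib[symmetric])
  ultimately have "p \<in> ?K"
    using convexD[OF convex_convex_hull r(2) k(4), of "u / ?D" "s * v / ?D"] k s D by simp
  then show False
    using p_outside by contradiction
qed

text \<open>By \<open>same_side\<close> the sign criterion for crossing reads the same at
  \<open>p\<close> and at \<open>a\<close>. This transfers crossings with arcs that do not end at
  \<open>a\<close>.\<close>

lemma puncture_crossing_iff:
  assumes "y \<in> V - {a}" "z \<in> V - {a}" "y \<noteq> z" "x \<in> P"
  shows "open_segment p x \<inter> open_segment y z \<noteq> {} \<longleftrightarrow>
    open_segment a x \<inter> open_segment y z \<noteq> {}"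
proof -
  have "side y z p * side y z x < 0 \<longleftrightarrow> side y z a * side y z x < 0"
    using same_side[OF assms(1-3)] by (auto simp: mult_less_0_iff zero_less_mult_iff)
  moreover have "side y z p \<noteq> 0" "side y z a \<noteq> 0"
    using same_side[OF assms(1-3)] by auto
  ultimately show ?thesis
    using assms p_in_P vertex_in_P[OF a_vertex] crossing_iff[of y z p x] crossing_iff[of y z a x]
    by simp
qed

section \<open>The contraction of a triangulation is a triangulation\<close>

lemma contract_subset_arcs:
  assumes "T \<subseteq> marked_arcs (insert p V)"
  shows "contract a p T \<subseteq> marked_arcs V"
proof
  fix g
  assume "g \<in> contract a p T"
  then consider "g \<in> T" "p \<notin> g" | x where "x \<noteq> a" "g = closed_segment a x" "closed_segment p x \<in> T"
    by (auto simp: mem_contract_iff)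
  then show "g \<in> marked_arcs V"
  proof cases
    case 1
    then show ?thesis
      using assms closed_segment_in_arcs by (metis subsetD unpunctured_arcE)
  next
    case 2
    then have "x \<in> V"
      using assms by (auto simp: closed_segment_in_marked_arcs_iff dest!: subsetD)
    then show ?thesis
      using 2 a_vertex closed_segment_in_arcs by auto
  qed
qed

text \<open>Two unmoved arcs are disjoint as before, and two moved ones share the end
  \<open>a\<close>. For a moved and an unmoved arc, either they share \<open>a\<close> or
  \<open>puncture_crossing_iff\<close> applies.\<close>

lemma contract_noncrossing:
  assumes T: "triangulation (insert p V) T"
  shows "pairwise noncrossing (contract a p T)"
proof -
  have arcs: "T \<subseteq> marked_arcs (insert p V)"
    using T by (simp add: triangulation_def)
  have vertex: "x \<in> V" if "closed_segment p x \<in> T" for x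
    using that arcs by (auto simp: closed_segment_in_marked_arcs_iff dest!: subsetD)
  have mixed: "noncrossing (closed_segment a x) e"
    if x: "x \<noteq> a" "closed_segment p x \<in> T" and e: "e \<in> T" "p \<notin> e" "e \<noteq> closed_segment a x" for x e
  proof -
    obtain y z where yz: "y \<in> V" "z \<in> V" "y \<noteq> z" "e = closed_segment y z"
      using e arcs by (meson subsetD unpunctured_arcE)
    have xV: "x \<in> V"
      using x vertex by blast
    have "open_segment a x \<inter> open_segment y z = {}"
    proof (cases "a = y \<or> a = z")
      case True
      then show ?thesis
        using disjoint_from_common[of x _ a] e yz xV a_vertex vertex_in_P
        by (metis closed_segment_commute open_segment_commute)
    next
      case False
      have "noncrossing (closed_segment p x) e"
        using triangulation_noncrossing[OF T x(2) e(1)] e(2) by auto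
      then have "open_segment p x \<inter> open_segment y z = {}"
        using yz xV by (simp add: noncrossing_puncture_arc)
      then show ?thesis
        using puncture_crossing_iff[of y z x] False yz xV vertex_in_P by auto
    qed
    then show ?thesis
      using x yz by (simp add: noncrossing_closed_segment)
  qed
  have star: "noncrossing (closed_segment a x) (closed_segment a w)"
    if "x \<noteq> a" "w \<noteq> a" "x \<noteq> w" "closed_segment p x \<in> T" "closed_segment p w \<in> T" for x w
    using that vertex disjoint_from_common[of x w a] a_vertex vertex_in_P
    by (simp add: noncrossing_closed_segment)
  show ?thesis
  proof (rule pairwiseI)
    fix e f
    assume "e \<in> contract a p T" "f \<in> contract a p T" "e \<noteq> f"
    then show "noncrossing e f"
      unfolding mem_contract_iff
      using mixed star triangulation_noncrossing[OF T] noncrossing_sym by metis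
  qed
qed

text \<open>An arc \<open>g\<close> of \<open>T'\<close> away from \<open>a\<close> crosses nothing
  in \<open>T\<close>, hence belongs to \<open>T\<close>. An arc \<open>a x\<close> is the image of
  \<open>p x\<close> if that is in \<open>T\<close>; if not, an arc of \<open>T\<close> blocking
  \<open>p x\<close> must end at \<open>a\<close>, and it shields \<open>a x\<close> from all arcs
  at \<open>p\<close>, so \<open>a x\<close> is in \<open>T\<close>.\<close>

lemma contract_maximal:
  assumes T: "triangulation (insert p V) T"
    and sub: "contract a p T \<subseteq> T'" and arcs': "T' \<subseteq> marked_arcs V"
    and T': "pairwise noncrossing T'"
  shows "T' \<subseteq> contract a p T"
proof
  have arcs: "T \<subseteq> marked_arcs (insert p V)"
    using T by (simp add: triangulation_def)
  have vertex: "x \<in> V" if "closed_segment p x \<in> T" for x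
    using that arcs by (auto simp: closed_segment_in_marked_arcs_iff dest!: subsetD)
  have old: "noncrossing g e" if "g \<in> T'" "e \<in> T" "p \<notin> e" "e \<noteq> g" for g e
  proof -
    have "e \<in> T'"
      using that sub by (auto simp: mem_contract_iff)
    then show ?thesis
      using that T' by (auto simp: pairwise_def)
  qed
  fix g
  assume g: "g \<in> T'"
  then obtain y z where yz: "g = closed_segment y z" "y \<in> V" "z \<in> V" "y \<noteq> z"
    using arcs' by (auto elim!: marked_arcsE dest!: subsetD)
  show "g \<in> contract a p T"
  proof (cases "a = y \<or> a = z")
    case False
    then have a: "y \<in> V - {a}" "z \<in> V - {a}"
      using yz by auto
    then have p: "p \<notin> g"
      using closed_segment_subset_hull p_outside yz by blast
    have "g \<in> T"
    proof (rule triangulation_memI[OF T])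
      show "g \<in> marked_arcs (insert p V)"
        using p yz closed_segment_in_punctured_arcs by (auto simp: closed_segment_eq_open)
      fix e
      assume e: "e \<in> T" "e \<noteq> g"
      show "noncrossing g e"
      proof (cases "p \<in> e")
        case True
        then obtain x where x: "x \<in> V" "e = closed_segment p x"
          using e arcs by (meson subsetD punctured_arcE)
        have "open_segment a x \<inter> open_segment y z = {}"
        \<comment> \<open>The arc from \<open>p\<close> to \<open>a\<close> has no image to compare
          with, but then \<open>open_segment a x\<close> is empty.\<close>
        proof (cases "x = a")
          case False
          then have "closed_segment a x \<in> contract a p T"
            using x e(1) by (auto simp: mem_contract_iff)
          then have "closed_segment a x \<in> T'"
            using sub by blast
          moreover have "closed_segment a x \<noteq> g"
            using yz a by (auto simp: doubleton_eq_iff)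
          ultimately have "noncrossing (closed_segment a x) g"
            using T' g by (auto simp: pairwise_def)
          then show ?thesis
            using False yz by (simp add: noncrossing_closed_segment)
        qed auto
        then have "open_segment p x \<inter> open_segment y z = {}"
          using puncture_crossing_iff[OF a] yz x vertex_in_P by auto
        then show ?thesis
          using x yz by (simp add: noncrossing_puncture_arc)
      qed (use g e old in auto)
    qed
    then show ?thesis
      using p by (simp add: mem_contract_iff)
  next
    case True
    then obtain x where x: "x \<in> V" "x \<noteq> a" "g = closed_segment a x"
      using yz by (metis closed_segment_commute)
    show ?thesis
    proof (cases "closed_segment p x \<in> T")
      case True
      then show ?thesis
        using x by (auto simp: mem_contract_iff)
    next
      case False
      then obtain e where e: "e \<in> T" "\<not> noncrossing (closed_segment p x) e"
        using triangulation_memI[OF T puncture_arc_in_punctured_arcs[OF x(1)]] by blast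
      have "p \<notin> e"
      proof
        assume "p \<in> e"
        then obtain w where w: "w \<in> V" "e = closed_segment p w"
          using e arcs by (meson subsetD punctured_arcE)
        then have "x \<noteq> w" "p \<noteq> w"
          using e(1) False p_not_vertex by auto
        then show False
          using e(2) w x(1) disjoint_from_common[of x w p] p_in_P
          by (simp add: noncrossing_puncture_arc)
      qed
      then obtain b c where bc: "b \<in> V" "c \<in> V" "b \<noteq> c" "e = closed_segment b c"
        using e arcs by (meson subsetD unpunctured_arcE)
      have px: "open_segment p x \<inter> open_segment b c \<noteq> {}"
        using e bc x by (simp add: noncrossing_puncture_arc)
      \<comment> \<open>A blocking arc away from \<open>a\<close> would cross \<open>g\<close> as
        well, although it is its own image and thus lies in \<open>T'\<close> with
        \<open>g\<close>.\<close>
      have "a = b \<or> a = c"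
      proof (rule ccontr)
        assume "\<not> (a = b \<or> a = c)"
        then have "open_segment a x \<inter> open_segment b c \<noteq> {}" "e \<noteq> g"
          using puncture_crossing_iff[of b c x] px bc x vertex_in_P by (auto simp: doubleton_eq_iff)
        then show False
          using old[OF g e(1) \<open>p \<notin> e\<close>] x bc by (simp add: noncrossing_closed_segment)
      qed
      then obtain d where d: "d \<in> V" "d \<noteq> a" "e = closed_segment a d"
        "open_segment p x \<inter> open_segment a d \<noteq> {}"
        using bc px by (metis closed_segment_commute open_segment_commute)
      have p0: "side a d p \<noteq> 0"
        using on_line_imp_on_arc[of a d p] d \<open>p \<notin> e\<close> a_vertex p_in_P by auto
      \<comment> \<open>The arc \<open>a d\<close> separates \<open>p\<close> from \<open>x\<close>, so every arc from \<open>p\<close> that crosses \<open>a x\<close> also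
        crosses \<open>a d\<close>.\<close>
      have opposite: "side a d p * side a d x < 0"
        using crossing_iff[of a d p x] d x p0 a_vertex p_in_P vertex_in_P by auto
      have separated: "side a d p * side a d r < 0" if r: "r \<in> open_segment a x" for r
      proof -
        obtain t where "0 < t" "side a d r = t * side a d x"
          using side_open_segment[OF r, of a d] by auto
        then show ?thesis
          using opposite by (simp add: mult_less_0_iff zero_less_mult_iff)
      qed
      have p: "p \<notin> g"
      proof -
        have "p \<notin> open_segment a x"
          using separated[of p] by (auto simp: mult_less_0_iff)
        then show ?thesis
          using x a_vertex p_not_vertex by (auto simp: closed_segment_eq_open)
      qed
      have "g \<in> T"
      proof (rule triangulation_memI[OF T])
        show "g \<in> marked_arcs (insert p V)"
          using p x a_vertex closed_segment_in_punctured_arcs by (auto simp: closed_segment_eq_open)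
        fix f
        assume f: "f \<in> T" "f \<noteq> g"
        show "noncrossing g f"
        proof (cases "p \<in> f")
          case True
          then obtain w where w: "w \<in> V" "f = closed_segment p w"
            using f arcs by (meson subsetD punctured_arcE)
          show ?thesis
          proof (rule ccontr)
            assume "\<not> noncrossing g f"
            then obtain r where r: "r \<in> open_segment a x" "r \<in> open_segment p w"
              using x w by (auto simp: noncrossing_puncture_arc)
            have "r \<in> P"
              using r(1) x a_vertex vertex_in_P convex_P
              by (meson convex_contains_open_segment subsetD)
            then have "open_segment p r \<inter> open_segment a d \<noteq> {}"
              using crossing_iff[of a d p r] separated[OF r(1)] d p0 a_vertex p_in_P by auto
            \<comment> \<open>The piece of \<open>p w\<close> up to \<open>r\<close> already crosses
              the arc \<open>a d\<close>.\<close>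
            moreover have "open_segment p r \<subseteq> open_segment p w"
              using r(2) by (auto simp: subset_open_segment closed_segment_eq_open)
            ultimately have "open_segment p w \<inter> open_segment a d \<noteq> {}"
              by blast
            then have "\<not> noncrossing f e"
              using w d by (simp add: noncrossing_puncture_arc)
            moreover have "f \<noteq> e"
              using True \<open>p \<notin> e\<close> by auto
            ultimately show False
              using triangulation_noncrossing[OF T f(1) e(1)] by simp
          qed
        qed (use g f old in auto)
      qed
      then show ?thesis
        using p by (simp add: mem_contract_iff)
    qed
  qed
qed

lemma triangulation_contract:
  assumes "triangulation (insert p V) T"
  shows "triangulation V (contract a p T)"
proof -
  have "contract a p T \<subseteq> marked_arcs V"
    using assms by (intro contract_subset_arcs) (simp add: triangulation_def)
  then show ?thesis
    using contract_noncrossing[OF assms] contract_maximal[OF assms]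
    by (auto simp: triangulation_def)
qed

text \<open>Since \<open>p\<close> is outside the hull of the other vertices, the triangle or edge
  of \<open>T\<close> containing it has \<open>a\<close> as a vertex. The new arcs at
  \<open>p\<close> then contract to sides of \<open>T\<close> at \<open>a\<close>, among them the
  edge removed in the second case.\<close>

lemma contract_puncture_flip:
  assumes T: "triangulation V T" and T': "triangulation (insert p V) T'"
    and flip: "flips_puncture_into p T T'"
  shows "contract a p T' = T"
proof -
  have arcs: "T \<subseteq> marked_arcs V"
    using T by (simp add: triangulation_def)
  have vertex: "x \<in> V \<and> y \<in> V" if "closed_segment x y \<in> T" for x y
    using that arcs closed_segment_in_marked_arcs_iff by blast
  \<comment> \<open>An arc of \<open>T\<close> has vertices as end points; if it survives in
    \<open>T'\<close>, the marked point \<open>p\<close> cannot be interior to it.\<close>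
  have avoid: "p \<notin> e" if e: "e \<in> T" "e \<in> T'" for e
  proof -
    have "e \<in> marked_arcs V"
      using e(1) arcs by blast
    then obtain x y where xy: "e = closed_segment x y" "x \<in> V" "y \<in> V"
      by (rule marked_arcsE)
    have "e \<in> marked_arcs (insert p V)"
      using e(2) T' by (auto simp: triangulation_def)
    then have "p \<notin> open_segment x y"
      unfolding xy(1) closed_segment_in_marked_arcs_iff by blast
    then show ?thesis
      using p_not_vertex xy by (auto simp: closed_segment_eq_open)
  qed
  from flip show ?thesis
  proof cases
    case (in_triangle b c d)
    then have bcd: "closed_segment b c \<in> T" "closed_segment c d \<in> T" "closed_segment b d \<in> T"
      by (auto simp: triangle_in_def)
    have "a \<in> {b, c, d}"
    proof (rule ccontr)
      assume "a \<notin> {b, c, d}"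
      then have "{b, c, d} \<subseteq> V - {a}"
        using bcd vertex by blast
      then show False
        using in_triangle(3) interior_subset hull_mono p_outside by blast
    qed
    then have "closed_segment a ` ({b, c, d} - {a}) \<subseteq> T"
      using bcd by (auto simp: closed_segment_commute)
    moreover have eq: "T' = T \<union> closed_segment p ` {b, c, d}"
      using in_triangle(1) by auto
    moreover have "p \<notin> e" if "e \<in> T" for e
      using avoid that eq by auto
    ultimately show ?thesis
      using contract_star[of T p a "{b, c, d}"] by auto
  next
    case (on_edge b c d e)
    then have sides: "closed_segment b c \<in> T" "closed_segment c d \<in> T" "closed_segment b d \<in> T"
        "closed_segment c e \<in> T" "closed_segment b e \<in> T"
      and ne: "b \<noteq> c" "c \<noteq> d" "b \<noteq> d" "c \<noteq> e" "b \<noteq> e"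
      by (auto simp: triangle_in_def)
    have "a = b \<or> a = c"
    proof (rule ccontr)
      assume "\<not> (a = b \<or> a = c)"
      then have "closed_segment b c \<subseteq> convex hull (V - {a})"
        using vertex sides by (intro closed_segment_subset_hull) auto
      then show False
        using on_edge(5) p_outside segment_open_subset_closed by blast
    qed
    then have sub: "closed_segment a ` ({b, c, d, e} - {a}) \<subseteq> T"
      \<comment> \<open>The removed edge returns as the image of the arc from \<open>p\<close> to
        its end other than \<open>a\<close>.\<close>
      and edge: "closed_segment b c \<in> closed_segment a ` ({b, c, d, e} - {a})"
      using sides ne by (auto simp: closed_segment_commute)
    have eq: "T' = (T - {closed_segment b c}) \<union> closed_segment p ` {b, c, d, e}"
      using on_edge(1) by auto
    have "p \<notin> f" if "f \<in> T - {closed_segment b c}" for f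
      using avoid that eq by auto
    then have "contract a p T' =
        (T - {closed_segment b c}) \<union> closed_segment a ` ({b, c, d, e} - {a})"
      unfolding eq by (rule contract_star)
    also have "\<dots> = T"
      using sub edge sides(1) by blast
    finally show ?thesis .
  qed
qed

end

section \<open>Strong convexity\<close>

lemma extended_flip_graph_arcE:
  assumes "(u, v) \<in> parcs (extended_flip_graph P p)"
  obtains (unpunctured) T T' where "u = Inl T" "v = Inl T'"
      "(T, T') \<in> parcs (flip_graph (polygon_vertices P))"
    | (punctured) T T' where "u = Inr T" "v = Inr T'"
      "triangulation (insert p (polygon_vertices P)) T"
      "triangulation (insert p (polygon_vertices P)) T'" "differ_by_single_arc T T'"
    | (insertion) T T' where "u = Inl T" "v = Inr T'" "triangulation (polygon_vertices P) T"
      "triangulation (insert p (polygon_vertices P)) T'" "flips_puncture_into p T T'"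
    | (removal) T T' where "u = Inr T'" "v = Inl T" "triangulation (polygon_vertices P) T"
      "triangulation (insert p (polygon_vertices P)) T'" "flips_puncture_into p T T'"
proof -
  consider "(u, v) \<in> map_prod Inl Inl ` parcs (flip_graph (polygon_vertices P))"
    | "(u, v) \<in> map_prod Inr Inr ` parcs (flip_graph (insert p (polygon_vertices P)))"
    | "(u, v) \<in> puncture_edges P p" | "(v, u) \<in> puncture_edges P p"
    using assms unfolding extended_flip_graph_def Let_def by auto
  then show thesis
  proof cases
    case 1
    then show ?thesis
      using unpunctured by auto
  next
    case 2
    then show ?thesis
      using punctured unfolding flip_graph_def by auto
  next
    case 3
    then show ?thesis
      using insertion unfolding puncture_edges_def by blast
  next
    case 4
    then show ?thesis
      using removal unfolding puncture_edges_def by blast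
  qed
qed

context puncture_near_vertex
begin

abbreviation retraction :: "point set set + point set set \<Rightarrow> point set set + point set set" where
  "retraction \<equiv> case_sum Inl (Inl \<circ> contract a p)"

lemma strongly_convex_flip_graph:
  "strongly_convex (graph_image Inl (flip_graph V)) (extended_flip_graph P p)"
proof (rule strongly_convex_retract[where f = retraction])
  let ?X = "graph_image Inl (flip_graph V)"
  let ?Y = "extended_flip_graph P p"
  have "wf_digraph ?Y" "wf_digraph ?X"
    by unfold_locales
      (auto simp: extended_flip_graph_def graph_image_def flip_graph_def puncture_edges_def Let_def)
  then show "subgraph ?X ?Y"
    by (auto simp: subgraph_def compatible_def extended_flip_graph_def graph_image_def Let_def)
  have mem_parcs: "(Inl T, Inl T') \<in> parcs ?X \<longleftrightarrow> (T, T') \<in> parcs (flip_graph V)" for T T'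
    by (auto simp: graph_image_def)
  show "(u, v) \<in> parcs ?X" if "(u, v) \<in> parcs ?Y" "u \<in> pverts ?X" "v \<in> pverts ?X" for u v
    using that(1)
  proof (cases rule: extended_flip_graph_arcE)
    case unpunctured
    then show ?thesis
      by (simp add: mem_parcs)
  qed (use that(2,3) in \<open>auto simp: graph_image_def\<close>)
  show "retraction v \<in> pverts ?X" if "v \<in> pverts ?Y" for v
    using that triangulation_contract
    by (auto simp: extended_flip_graph_def graph_image_def flip_graph_def Let_def)
  show "retraction v = v" if "v \<in> pverts ?X" for v
    using that by (auto simp: graph_image_def)
  show "retraction u = retraction v \<or> (retraction u, retraction v) \<in> parcs ?X"
    if "(u, v) \<in> parcs ?Y" for u v
    using that
  proof (cases rule: extended_flip_graph_arcE)
    case unpunctured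
    then show ?thesis
      by (simp add: mem_parcs)
  next
    case (punctured T T')
    then have "contract a p T = contract a p T' \<or>
        (contract a p T, contract a p T') \<in> parcs (flip_graph V)"
      using contract_flip[of V a p T T'] triangulation_contract by (simp add: flip_graph_def)
    then show ?thesis
      using punctured(1,2) by (simp add: mem_parcs)
  next
    case (insertion T T')
    then show ?thesis
      using contract_puncture_flip[of T T'] by simp
  next
    case (removal T T')
    then show ?thesis
      using contract_puncture_flip[of T T'] by simp
  qed
  \<comment> \<open>Only an \<open>insertion\<close> arc leads out of \<open>?X\<close>, and
    contraction undoes the insertion.\<close>
  show "retraction u = retraction v"
    if "(u, v) \<in> parcs ?Y" "u \<in> pverts ?X" "v \<notin> pverts ?X" for u v
    using that(1)
  proof (cases rule: extended_flip_graph_arcE)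
    case (unpunctured T T')
    then show ?thesis
      using that(3) by (simp add: graph_image_def flip_graph_def)
  next
    case (insertion T T')
    then show ?thesis
      using contract_puncture_flip[of T T'] by simp
  qed (use that(2) in \<open>auto simp: graph_image_def\<close>)
qed

end

text \<open>If the hull \<open>?K\<close> of the other vertices covered the interior, then, being
  closed, it would contain \<open>a\<close>. As an extreme point of \<open>P\<close>, hence of
  \<open>?K\<close>, the vertex \<open>a\<close> would be one of the points spanning
  \<open>?K\<close>.\<close>

lemma ex_puncture_near_vertex:
  assumes "convex_ngon n P"
  shows "\<exists>a p. puncture_near_vertex P a p"
proof -
  let ?V = "polygon_vertices P"
  have P: "polytope P" "interior P \<noteq> {}" "card ?V \<ge> 3"
    using assms by (auto simp: convex_ngon_def)
  have hull: "P = convex hull ?V"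
    using P(1) unfolding polygon_vertices_def
    by (intro Krein_Milman_Minkowski polytope_imp_compact polytope_imp_convex)
  \<comment> \<open>An infinite vertex set would have \<open>card\<close> 0.\<close>
  have fin: "finite ?V"
    using P(3) card.infinite by fastforce
  obtain a where a: "a \<in> ?V"
    using P(3) by fastforce
  let ?K = "convex hull (?V - {a})"
  have "\<not> interior P \<subseteq> ?K"
  proof
    assume "interior P \<subseteq> ?K"
    then have "closure (interior P) \<subseteq> ?K"
      using fin by (intro closure_minimal compact_imp_closed finite_imp_compact_convex_hull) auto
    moreover have "a \<in> closure (interior P)"
      using a P closure_subset[of P]
      by (auto simp: convex_closure_interior polytope_imp_convex polygon_vertices_def
          extreme_point_of_def)
    ultimately have "a \<in> ?K"
      by blast
    moreover have "?K \<subseteq> P"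
      using hull hull_mono[of "?V - {a}" ?V] by auto
    ultimately have "a extreme_point_of ?K"
      using a by (auto simp: polygon_vertices_def extreme_point_of_def)
    then show False
      using extreme_point_of_convex_hull by blast
  qed
  then obtain p where "p \<in> interior P" "p \<notin> ?K"
    by blast
  then have "puncture_near_vertex P a p"
    using hull a by unfold_locales
  then show ?thesis
    by blast
qed

theorem theorem1p3:
  fixes n :: nat and P :: "(real ^ 2) set"
  assumes "convex_ngon n P"
  shows "\<exists>p \<in> interior P.
           strongly_convex_embedding Inl (flip_graph (polygon_vertices P)) (extended_flip_graph P p)"
proof -
  obtain a p where "puncture_near_vertex P a p"
    using ex_puncture_near_vertex[OF assms] by blast
  then interpret puncture_near_vertex P a p .
  show ?thesis
    using p_interior strongly_convex_flip_graph
    by (intro bexI[of _ p]) (auto simp: strongly_convex_embedding_def)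
qed

end
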